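(* Let $G$ be a finite simple graph with vertices numbered $1,\dots,n$. The algorithm EnumCB, which calls $\mathrm{Rec}(\emptyset)$, where $\mathrm{Rec}(X)$ outputs $X$ and then, for each $v\in C(X)$ with $\mathrm{Par}(X\cup\{v\})=X$, calls $\mathrm{Rec}(X\cup\{v\})$, enumerates all solutions of $G$ (outputs every vertex set $X$ such that $G[X]$ is chordal bipartite, without duplication).
   Context: For $S\subseteq V$, $G[S]$ is the induced subgraph and $N_S(u)=N(u)\cap S$. In $G[S]$, $a,b$ are comparable if $N_S(a)\subseteq N_S(b)$ or $N_S(b)\subseteq N_S(a)$; $u\in S$ is weak-simplicial in $G[S]$ if $N_S(u)$ is independent and any two vertices of $N_S(u)$ are comparable in $G[S]$. A solution is a set $X\subseteq V$ (possibly empty) with $G[X]$ chordal bipartite (bipartite with no induced cycle of length $\ge 6$). $WS(X)$ is the set of weak-simplicial vertices of $G[X]$; for nonempty $X$, $pv(X)=\max WS(X)$ and $\mathrm{Par}(X)=X\setminus\{pv(X)\}$. $AWS(X)=\{v\in V\setminus X: v\in WS(X\cup\{v\})\}$. $N^{1:2}(p)$ is the set of vertices at distance $1$ or $2$ from $p$ in $G$. For nonempty $X$, $C(X)=\{u\in AWS(X): u\ge pv(X)\}\cup(AWS(X)\cap N^{1:2}(pv(X)))$, and $C(\emptyset)=AWS(\emptyset)=V$. *)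

theory Defs
  imports "Graph_Theory.Digraph_Component" "Graph_Theory.Shortest_Path"
begin

text \<open>
  Finite simple graphs are the locale \<^locale>\<open>graph\<close>, that is, finite symmetric loopfree digraphs
  without parallel arcs. \<open>G[S]\<close> is the library's \<open>G \<restriction> S\<close>; for \<open>u \<in> S\<close>, the set \<open>N\<^sub>S(u)\<close> is
  \<open>nbhd (G \<restriction> S) u\<close>.
\<close>

definition nbhd :: "('a, 'b) pre_digraph \<Rightarrow> 'a \<Rightarrow> 'a set" where
  "nbhd H u = {v. u \<rightarrow>\<^bsub>H\<^esub> v}"

definition independent_set :: "('a, 'b) pre_digraph \<Rightarrow> 'a set \<Rightarrow> bool" where
  "independent_set H S \<longleftrightarrow> S \<subseteq> verts H \<and> (\<forall>a\<in>S. \<forall>b\<in>S. \<not> a \<rightarrow>\<^bsub>H\<^esub> b)"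

definition comparable :: "('a, 'b) pre_digraph \<Rightarrow> 'a \<Rightarrow> 'a \<Rightarrow> bool" where
  "comparable H a b \<longleftrightarrow> nbhd H a \<subseteq> nbhd H b \<or> nbhd H b \<subseteq> nbhd H a"

definition weak_simplicial :: "('a, 'b) pre_digraph \<Rightarrow> 'a \<Rightarrow> bool" where
  "weak_simplicial H u \<longleftrightarrow>
     u \<in> verts H \<and> independent_set H (nbhd H u) \<and>
     (\<forall>a\<in>nbhd H u. \<forall>b\<in>nbhd H u. comparable H a b)"

definition bipartite :: "('a, 'b) pre_digraph \<Rightarrow> bool" where
  "bipartite H \<longleftrightarrow>
     (\<exists>A B. verts H = A \<union> B \<and> A \<inter> B = {} \<and> independent_set H A \<and> independent_set H B)"

text \<open>
  An undirected induced cycle is given by the cyclic list of its vertices. The library's cycles are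
  directed closed walks (in a symmetric digraph, \<open>a, b, a\<close> is one of them) and may have chords.
\<close>

definition induced_cycle :: "('a, 'b) pre_digraph \<Rightarrow> 'a list \<Rightarrow> bool" where
  "induced_cycle H vs \<longleftrightarrow>
     3 \<le> length vs \<and> distinct vs \<and> set vs \<subseteq> verts H \<and>
     (\<forall>i<length vs. \<forall>j<length vs.
        vs ! i \<rightarrow>\<^bsub>H\<^esub> vs ! j \<longleftrightarrow>
          j = Suc i mod length vs \<or> i = Suc j mod length vs)"

definition chordal_bipartite :: "('a, 'b) pre_digraph \<Rightarrow> bool" where
  "chordal_bipartite H \<longleftrightarrow> bipartite H \<and> \<not> (\<exists>vs. induced_cycle H vs \<and> 6 \<le> length vs)"

definition solution :: "('a, 'b) pre_digraph \<Rightarrow> 'a set \<Rightarrow> bool" where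
  "solution G X \<longleftrightarrow> X \<subseteq> verts G \<and> chordal_bipartite (G \<restriction> X)"

definition WS :: "('a, 'b) pre_digraph \<Rightarrow> 'a set \<Rightarrow> 'a set" where
  "WS G X = {u. weak_simplicial (G \<restriction> X) u}"

definition AWS :: "('a, 'b) pre_digraph \<Rightarrow> 'a set \<Rightarrow> 'a set" where
  "AWS G X = {v \<in> verts G - X. v \<in> WS G (X \<union> {v})}"

text \<open>
  \<open>Max\<close> is unspecified on the empty set, so \<open>pv G X\<close> is meaningful only if \<open>G \<restriction> X\<close> has a
  weak-simplicial vertex.
\<close>

definition pv :: "(nat, 'b) pre_digraph \<Rightarrow> nat set \<Rightarrow> nat" where
  "pv G X = Max (WS G X)"

definition Par :: "(nat, 'b) pre_digraph \<Rightarrow> nat set \<Rightarrow> nat set" where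
  "Par G X = X - {pv G X}"

text \<open>With unit arc weights, the library's shortest-path cost \<open>\<mu>\<close> is the distance in the graph.\<close>

definition N12 :: "('a, 'b) pre_digraph \<Rightarrow> 'a \<Rightarrow> 'a set" where
  "N12 G p = {u \<in> verts G. wf_digraph.\<mu> G (\<lambda>_. 1) p u \<in> {1, 2}}"

definition C :: "(nat, 'b) pre_digraph \<Rightarrow> nat set \<Rightarrow> nat set" where
  "C G X =
     (if X = {} then AWS G {}
      else {u \<in> AWS G X. pv G X \<le> u} \<union> (AWS G X \<inter> N12 G (pv G X)))"

text \<open>
  \<open>Rec G X outs\<close>: some terminating execution of \<open>Rec(X)\<close> outputs exactly the sequence \<open>outs\<close>.
  The loop over \<open>C G X\<close> may visit its elements in any order \<open>vs\<close>, chosen anew in each call.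
  The relation being inductive, executions that do not terminate are not related to any \<open>outs\<close>.
\<close>

inductive Rec :: "(nat, 'b) pre_digraph \<Rightarrow> nat set \<Rightarrow> nat set list \<Rightarrow> bool"
  for G :: "(nat, 'b) pre_digraph" where
  "\<lbrakk> distinct vs; set vs = C G X;
     list_all2 (\<lambda>v outs. Rec G (X \<union> {v}) outs)
       (filter (\<lambda>v. Par G (X \<union> {v}) = X) vs) outss \<rbrakk>
   \<Longrightarrow> Rec G X (X # concat outss)"

definition EnumCB :: "(nat, 'b) pre_digraph \<Rightarrow> nat set list \<Rightarrow> bool" where
  "EnumCB G outs \<longleftrightarrow> Rec G {} outs"

end

theory Submission
  imports Defs
begin

text \<open>
  The reverse search is correct because every nonempty solution has a weak-simplicial vertex, and
  adding or deleting a weak-simplicial vertex preserves chordal bipartiteness. The parent relation is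
  then a tree rooted at \<open>{}\<close>. It remains to see that \<open>v = pv(Y)\<close> lies in \<open>C(Par(Y))\<close>: if
  \<open>v < p = pv(Par(Y))\<close>, then \<open>p\<close> stopped being weak-simplicial when \<open>v\<close> was added, which forces \<open>v\<close>
  to be within distance 2 of \<open>p\<close>.

  For the existence of a weak-simplicial vertex, order the vertices so that the bipartite adjacency
  matrix is doubly lexical and take the first vertex \<open>u\<close> of a side. If two neighbours of \<open>u\<close> are
  incomparable, repeatedly taking the last place where two consecutive rows or columns differ
  extends an induced path at both ends. By finiteness its ends become adjacent at some point, which
  closes an induced cycle of length at least 6.
\<close>

section \<open>Doubly lexical orderings of bipartite graphs\<close>

lemma inj_on_increasing:
  fixes f :: "'a \<Rightarrow> 'b :: linorder" and r :: "nat \<Rightarrow> 'a"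
  assumes "\<And>i. i < k \<Longrightarrow> f (r i) < f (r (Suc i))"
  shows "inj_on r {..k}"
proof -
  have "f (r i) < f (r j)" if "i < j" "j \<le> k" for i j
    using that
  proof (induction j)
    case (Suc j)
    then show ?case using assms[of j] by (cases "i = j") auto
  qed simp
  then show ?thesis
    by (metis atMost_iff inj_onI linorder_neqE_nat order_less_irrefl)
qed

text \<open>Distinct powers of two below 2 ^ m are the bits of a number with m binary digits, so a
  single bit at position m outweighs all lower ones together.\<close>

lemma sum_power_less:
  fixes f :: "'a \<Rightarrow> nat"
  assumes "inj_on f D" and "\<And>w. w \<in> D \<Longrightarrow> f w < m"
  shows "(\<Sum>w\<in>D. 2 ^ f w :: nat) < 2 ^ m"
proof -
  have "(\<Sum>w\<in>D. 2 ^ f w :: nat) = (\<Sum>k\<in>f ` D. 2 ^ k)"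
    using assms(1) by (simp add: sum.reindex)
  also have "\<dots> \<le> (\<Sum>k<m. 2 ^ k)" using assms(2) by (intro sum_mono2) auto
  also have "\<dots> < 2 ^ m" by (simp add: lessThan_atLeast0 sum_power2)
  finally show ?thesis .
qed

text \<open>The two sides are parameters, so that whatever is shown for R carries over to S by
  \<open>bigraph_swap\<close>.\<close>

locale bigraph =
  fixes adj :: "'a \<Rightarrow> 'a \<Rightarrow> bool" and R S :: "'a set"
  assumes finite_R: "finite R" and finite_S: "finite S" and disjoint: "R \<inter> S = {}"
    and adj_sym: "adj u v \<Longrightarrow> adj v u"
    and adj_sides: "adj u v \<Longrightarrow> u \<in> R \<and> v \<in> S \<or> u \<in> S \<and> v \<in> R"
begin

lemma bigraph_swap: "bigraph adj S R"
  using finite_R finite_S disjoint adj_sym adj_sides by unfold_locales blast+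

text \<open>
  Reading neighbourhoods as binary numbers turns the lexicographic order, with the \<open>f\<close>-largest
  vertex most significant, into the order of \<^typ>\<open>nat\<close>. By the rearrangement inequality, exchanging
  two vertices of one side that are out of order increases the total weight below, so an ordering of
  maximal weight is doubly lexical.
\<close>

definition code :: "('a \<Rightarrow> nat) \<Rightarrow> 'a \<Rightarrow> nat" where
  "code f u = (\<Sum>v | adj u v. 2 ^ f v)"

definition weight :: "('a \<Rightarrow> nat) \<Rightarrow> 'a set \<Rightarrow> 'a set \<Rightarrow> nat" where
  "weight f A B = (\<Sum>u\<in>A. \<Sum>v\<in>B. if adj u v then 2 ^ f u * 2 ^ f v else 0)"

lemma adj_side: "adj u v \<Longrightarrow> u \<in> R \<Longrightarrow> v \<in> S"
  using adj_sides disjoint by blast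

lemma finite_nbrs: "finite {v. adj u v}"
  by (rule finite_subset[of _ "R \<union> S"]) (use adj_sides finite_R finite_S in auto)

lemma weight_commute: "weight f A B = weight f B A"
  unfolding weight_def
  by (subst sum.swap) (intro sum.cong refl if_cong, use adj_sym in auto)

lemma weight_eq_sum_code: "weight f R S = (\<Sum>u\<in>R. 2 ^ f u * code f u)"
  unfolding weight_def code_def
proof (intro sum.cong refl)
  fix u assume "u \<in> R"
  then have "{v. adj u v} = {v \<in> S. adj u v}" using adj_side by blast
  then show "(\<Sum>v\<in>S. if adj u v then 2 ^ f u * 2 ^ f v else 0) =
      2 ^ f u * (\<Sum>v | adj u v. 2 ^ f v :: nat)"
    using finite_S by (simp add: sum.inter_filter sum_distrib_left if_distrib cong: if_cong)
qed

lemma weight_swap_less: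
  assumes i: "i \<in> R" and j: "j \<in> R" and less: "f i < f j" and code: "code f j < code f i"
  shows "weight f R S < weight (f(i := f j, j := f i)) R S"
proof -
  let ?g = "f(i := f j, j := f i)"
  have "i \<noteq> j" using less by auto
  \<comment> \<open>The code of a vertex of R depends only on the values of f on S, which the
    exchange leaves alone.\<close>
  have code_g: "code ?g u = code f u" if "u \<in> R" for u
    unfolding code_def
    by (intro sum.cong refl) (use that i j adj_side disjoint in auto)
  have split: "(\<Sum>u\<in>R. h u) = h i + h j + (\<Sum>u\<in>R - {i, j}. h u)" for h :: "'a \<Rightarrow> nat"
    using sum.subset_diff[of "{i, j}" R h] i j \<open>i \<noteq> j\<close> finite_R by simp
  have rest: "(\<Sum>u\<in>R - {i, j}. 2 ^ ?g u * code ?g u) = (\<Sum>u\<in>R - {i, j}. 2 ^ f u * code f u)"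
    by (intro sum.cong refl) (simp add: code_g)
  have "(2::nat) ^ f i < 2 ^ f j" using less by simp
  \<comment> \<open>The two-term rearrangement inequality. Naming the differences avoids truncated
    subtraction.\<close>
  moreover have "a * c + b * d < b * c + a * d" if ab: "a < b" and dc: "d < c" for a b c d :: nat
  proof -
    obtain x where x: "b = Suc (a + x)" using less_imp_Suc_add[OF ab] by blast
    obtain y where y: "c = Suc (d + y)" using less_imp_Suc_add[OF dc] by blast
    show ?thesis unfolding x y by (simp add: algebra_simps)
  qed
  ultimately have "2 ^ f i * code f i + 2 ^ f j * code f j < 2 ^ f j * code f i + 2 ^ f i * code f j"
    using code by blast
  then show ?thesis
    unfolding weight_eq_sum_code split[of "\<lambda>u. 2 ^ f u * code f u"] split[of "\<lambda>u. 2 ^ ?g u * code ?g u"] rest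
    using \<open>i \<noteq> j\<close> by (simp add: code_g i j)
qed

text \<open>The same f sorts rows and columns of the adjacency matrix. Codes are compared by
  \<open>\<le>\<close> because vertices with equal neighbourhoods have equal codes.\<close>

definition doubly_lexical :: "('a \<Rightarrow> nat) \<Rightarrow> bool" where
  "doubly_lexical f \<longleftrightarrow> inj_on f (R \<union> S) \<and>
     (\<forall>u v. u \<in> R \<and> v \<in> R \<or> u \<in> S \<and> v \<in> S \<longrightarrow> f u < f v \<longrightarrow> code f u \<le> code f v)"

lemma ex_doubly_lexical: "\<exists>f. doubly_lexical f"
proof -
  let ?V = "R \<union> S" let ?n = "card ?V"
  \<comment> \<open>Confining the values to a fixed range bounds the weight, so a maximum exists;
    exchanging two values stays within P.\<close>
  define P where "P f \<longleftrightarrow> inj_on f ?V \<and> f ` ?V \<subseteq> {..<?n}" for f :: "'a \<Rightarrow> nat"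
  have fin: "finite ?V" using finite_R finite_S by simp
  obtain f0 where "bij_betw f0 ?V {0..<?n}"
    using ex_bij_betw_finite_nat[OF fin] by blast
  then have P0: "P f0" by (auto simp: P_def bij_betw_def)
  have bound: "weight f R S < Suc (\<Sum>u\<in>R. \<Sum>v\<in>S. 2 ^ ?n * 2 ^ ?n)" if "P f" for f
  proof -
    have "(if adj u v then 2 ^ f u * 2 ^ f v else 0) \<le> (2 ^ ?n * 2 ^ ?n :: nat)"
      if "u \<in> R" "v \<in> S" for u v
    proof -
      have "f u < ?n" "f v < ?n" using \<open>P f\<close> that by (auto simp: P_def)
      then show ?thesis
        using mult_mono[of "2 ^ f u" "2 ^ ?n" "2 ^ f v" "2 ^ ?n :: nat"] by simp
    qed
    then show ?thesis unfolding weight_def less_Suc_eq_le by (intro sum_mono)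
  qed
  have "\<exists>f. P f \<and> (\<forall>g. P g \<longrightarrow> weight g R S \<le> weight f R S)"
    using Lattices_Big.ex_has_greatest_nat[of P, OF P0 allI[OF impI[OF bound]]] .
  then obtain f where f: "P f"
    and max: "\<And>g. P g \<Longrightarrow> weight g R S \<le> weight f R S"
    by blast
  have swapped: "P (f(i := f j, j := f i))" if "i \<in> ?V" "j \<in> ?V" for i j
    using f that by (auto simp: P_def inj_on_def)
  have "code f u \<le> code f v" if "u \<in> R" "v \<in> R" "f u < f v" for u v
    using weight_swap_less[OF that] max[OF swapped[of u v]] that by (meson UnI1 not_le)
  moreover have "code f u \<le> code f v" if "u \<in> S" "v \<in> S" "f u < f v" for u v
  proof (rule ccontr)
    interpret s: bigraph adj S R by (rule bigraph_swap)
    assume "\<not> code f u \<le> code f v"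
    then have "weight f S R < weight (f(u := f v, v := f u)) S R"
      using s.weight_swap_less[OF that] by simp
    then show False
      using max[OF swapped[of u v]] that by (simp add: weight_commute[of _ S])
  qed
  ultimately show ?thesis using f unfolding doubly_lexical_def P_def by blast
qed

text \<open>The code of u is at most that of v, so the most significant position z where the two
  binary numbers differ holds a 1 for v and a 0 for u. At w they differ the other way round, hence z
  lies strictly beyond w.\<close>

lemma last_difference:
  assumes f: "doubly_lexical f" and side: "u \<in> R \<and> v \<in> R \<or> u \<in> S \<and> v \<in> S" and "f u < f v"
    and w: "adj u w" "\<not> adj v w"
  obtains z where "f w < f z" "adj v z" "\<not> adj u z"
    "\<And>y. y \<in> R \<union> S \<Longrightarrow> f z < f y \<Longrightarrow> adj u y = adj v y"
proof -
  let ?D = "{y. adj u y \<noteq> adj v y}"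
  have D: "?D \<subseteq> R \<union> S" using adj_sides by blast
  have inj: "inj_on f (R \<union> S)" using f by (simp add: doubly_lexical_def)
  have fin: "finite ?D" using D finite_R finite_S by (auto intro: finite_subset)
  have "?D \<noteq> {}" using w by blast
  then obtain z where z: "z \<in> ?D" and z_Max: "f z = Max (f ` ?D)"
    by (rule obtains_MAX[OF fin, of f]) metis
  have max: "f y \<le> f z" if "y \<in> ?D" for y
    unfolding z_Max using that fin by (intro Max_ge) auto
  have strict: "f y < f z" if "y \<in> ?D" "y \<noteq> z" for y
    using max[OF that(1)] inj D z that by (metis inj_onD le_neq_implies_less subset_iff)
  have "adj v z"
  proof (rule ccontr)
    assume nz: "\<not> adj v z"
    let ?I = "{y. adj u y \<and> adj v y}"
    have fin': "finite ?I" "finite {y. adj u y \<and> \<not> adj v y}" "finite {y. adj v y \<and> \<not> adj u y}"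
      using finite_nbrs[of u] finite_nbrs[of v] by (auto intro: finite_subset)
    \<comment> \<open>Common neighbours contribute equally to both codes. The neighbours of v alone
      all lie below z, so together they weigh less than the bit at z, which would belong to
      u.\<close>
    have "code f v = (\<Sum>y\<in>?I. 2 ^ f y) + (\<Sum>y | adj v y \<and> \<not> adj u y. 2 ^ f y)"
      unfolding code_def using fin'
      by (subst sum.union_disjoint[symmetric]) (auto intro: sum.cong)
    also have "\<dots> < (\<Sum>y\<in>?I. 2 ^ f y) + 2 ^ f z"
      using D nz strict by (intro add_strict_left_mono sum_power_less inj_on_subset[OF inj]) auto
    also have "\<dots> \<le> (\<Sum>y\<in>?I. 2 ^ f y) + (\<Sum>y | adj u y \<and> \<not> adj v y. 2 ^ f y)"
      using z nz fin' by (intro add_left_mono member_le_sum) auto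
    also have "\<dots> = code f u"
      unfolding code_def using fin'
      by (subst sum.union_disjoint[symmetric]) (auto intro: sum.cong)
    finally show False using f side \<open>f u < f v\<close> unfolding doubly_lexical_def by (meson not_le)
  qed
  moreover have "\<not> adj u z" using z calculation by simp
  moreover have "f w < f z" using strict[of w] w calculation by auto
  moreover have "adj u y = adj v y" if "f z < f y" for y using max[of y] that by fastforce
  ultimately show ?thesis using that by blast
qed

section \<open>Zigzag paths and long induced cycles\<close>

definition long_cycle :: "'a list \<Rightarrow> bool" where
  "long_cycle vs \<longleftrightarrow> 6 \<le> length vs \<and> distinct vs \<and> set vs \<subseteq> R \<union> S \<and>
     (\<forall>i<length vs. \<forall>j<length vs.
        adj (vs ! i) (vs ! j) \<longleftrightarrow> j = Suc i mod length vs \<or> i = Suc j mod length vs)"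

text \<open>The vertices form two strands, \<open>c 0, r 1, c 2, ...\<close> and
  \<open>r 0, c 1, r 2, ...\<close>, joined by an edge at index 0 and one at index K only. Going
  along the first strand and back along the second traverses an induced cycle with 2 * K + 2
  vertices.\<close>

lemma zigzag_closes:
  assumes K: "2 \<le> K"
    and r: "\<And>i. i \<le> K \<Longrightarrow> r i \<in> R" and c: "\<And>i. i \<le> K \<Longrightarrow> c i \<in> S"
    and inj: "inj_on r {..K}" "inj_on c {..K}"
    and rc: "\<And>i j. i \<le> K \<Longrightarrow> j \<le> K \<Longrightarrow>
      adj (r i) (c j) \<longleftrightarrow> i = 0 \<and> j = 0 \<or> i = Suc j \<or> j = Suc i \<or> i = K \<and> j = K"
  shows "\<exists>vs. long_cycle vs"
proof -
  define x where "x i = (if even i then c i else r i)" for i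
  define y where "y i = (if even i then r i else c i)" for i
  \<comment> \<open>Position K + 1 holds \<open>y K\<close>, and the last position 2 * K + 1 holds
    \<open>y 0\<close>, which closes the cycle at \<open>x 0\<close>.\<close>
  define z where "z i = (if i \<le> K then x i else y (2 * K + 1 - i))" for i
  let ?n = "2 * K + 2"
  have cr: "adj (c j) (r i) \<longleftrightarrow> adj (r i) (c j)" for i j using adj_sym by blast
  have rr: "\<not> adj (r i) (r j)" "\<not> adj (c i) (c j)" if "i \<le> K" "j \<le> K" for i j
    using r[OF that(1)] r[OF that(2)] c[OF that(1)] c[OF that(2)] adj_sides disjoint by blast+
  have xx: "adj (x i) (x j) \<longleftrightarrow> i = Suc j \<or> j = Suc i"
    and yy: "adj (y i) (y j) \<longleftrightarrow> i = Suc j \<or> j = Suc i"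
    and xy: "adj (x i) (y j) \<longleftrightarrow> i = j \<and> (i = 0 \<or> i = K)"
    and yx: "adj (y j) (x i) \<longleftrightarrow> i = j \<and> (i = 0 \<or> i = K)"
    if "i \<le> K" "j \<le> K" for i j
    using rc[OF that] rc[OF that(2,1)] rr[OF that] rr[OF that(2,1)] that
    by (auto simp: x_def y_def cr)
  have ne: "r i \<noteq> c j" if "i \<le> K" "j \<le> K" for i j using r c that disjoint by fastforce
  have zz: "z i = z j \<longleftrightarrow> i = j" if "i < ?n" "j < ?n" for i j
  proof -
    have ii: "r i = r j \<longleftrightarrow> i = j" "c i = c j \<longleftrightarrow> i = j" if "i \<le> K" "j \<le> K" for i j
      using inj that by (auto simp: inj_on_eq_iff)
    have "x i = x j \<longleftrightarrow> i = j" "y i = y j \<longleftrightarrow> i = j" "x i \<noteq> y j" "y j \<noteq> x i"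
      if "i \<le> K" "j \<le> K" for i j
      using that ne[OF that] ne[OF that(2,1)] ii[OF that] by (auto simp: x_def y_def)
    then show ?thesis using that by (auto simp: z_def)
  qed
  have "long_cycle (map z [0..<?n])"
    unfolding long_cycle_def
  proof (intro conjI allI impI)
    show "distinct (map z [0..<?n])"
      using zz by (auto simp: distinct_map inj_on_def)
    have "z i \<in> R \<union> S" if "i < ?n" for i
      using that r[of i] c[of i] r[of "2 * K + 1 - i"] c[of "2 * K + 1 - i"]
      by (auto simp: z_def x_def y_def)
    then show "set (map z [0..<?n]) \<subseteq> R \<union> S"
      by (simp del: upt_Suc add: image_subset_iff)
    fix i j assume "i < length (map z [0..<?n])" "j < length (map z [0..<?n])"
    then have i: "i < ?n" and j: "j < ?n" by simp_all
    have "adj (z i) (z j) \<longleftrightarrow> j = Suc i mod ?n \<or> i = Suc j mod ?n"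
    \<comment> \<open>The mixed cases account for the two edges between the strands: positions K and
      K + 1, and positions 2 * K + 1 and 0.\<close>
    proof (cases "i \<le> K"; cases "j \<le> K")
      assume "i \<le> K" "j \<le> K"
      then show ?thesis using K by (simp add: z_def xx mod_Suc) arith
    next
      assume "i \<le> K" "\<not> j \<le> K"
      then have "adj (z i) (z j) \<longleftrightarrow> i = 2 * K + 1 - j \<and> (i = 0 \<or> i = K)"
        using j xy[of i "2 * K + 1 - j"] by (simp add: z_def)
      then show ?thesis
        using K i j \<open>i \<le> K\<close> \<open>\<not> j \<le> K\<close> by (simp add: mod_Suc) arith
    next
      assume "\<not> i \<le> K" "j \<le> K"
      then have "adj (z i) (z j) \<longleftrightarrow> j = 2 * K + 1 - i \<and> (j = 0 \<or> j = K)"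
        using i yx[of j "2 * K + 1 - i"] by (simp add: z_def)
      then show ?thesis
        using K i j \<open>\<not> i \<le> K\<close> \<open>j \<le> K\<close> by (simp add: mod_Suc) arith
    next
      assume "\<not> i \<le> K" "\<not> j \<le> K"
      then have "adj (z i) (z j) \<longleftrightarrow> 2 * K + 1 - i = Suc (2 * K + 1 - j) \<or>
          2 * K + 1 - j = Suc (2 * K + 1 - i)"
        using i j yy[of "2 * K + 1 - i" "2 * K + 1 - j"] by (simp add: z_def)
      then show ?thesis
        using K i j \<open>\<not> i \<le> K\<close> \<open>\<not> j \<le> K\<close> by (simp add: mod_Suc) arith
    qed
    then show "adj (map z [0..<?n] ! i) (map z [0..<?n] ! j) \<longleftrightarrow>
      j = Suc i mod length (map z [0..<?n]) \<or> i = Suc j mod length (map z [0..<?n])"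
      using i j by (simp del: upt_Suc)
  qed (use K in simp)
  then show ?thesis by blast
qed

text \<open>
  The vertices \<open>\<dots>, r 2, c 1, r 0, c 0, r 1, c 2, \<dots>\<close> form an induced path. The last clause makes each new
  vertex, chosen as a last difference, nonadjacent to all but the most recent ones.
\<close>

definition zigzag :: "('a \<Rightarrow> nat) \<Rightarrow> (nat \<Rightarrow> 'a) \<Rightarrow> (nat \<Rightarrow> 'a) \<Rightarrow> nat \<Rightarrow> bool" where
  "zigzag f r c k \<longleftrightarrow>
     (\<forall>i\<le>k. r i \<in> R \<and> c i \<in> S) \<and>
     (\<forall>i\<le>k. \<forall>j\<le>k. adj (r i) (c j) \<longleftrightarrow> i = 0 \<and> j = 0 \<or> i = Suc j \<or> j = Suc i) \<and>
     (\<forall>i<k. f (r i) < f (r (Suc i)) \<and> f (c i) < f (c (Suc i))) \<and>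
     (\<forall>i. i + 2 \<le> k \<longrightarrow>
        (\<forall>w\<in>R. f (r (i + 2)) < f w \<longrightarrow> adj w (c i) = adj w (c (Suc i))) \<and>
        (\<forall>w\<in>S. f (c (i + 2)) < f w \<longrightarrow> adj (r i) w = adj (r (Suc i)) w))"

lemma zigzag_swap: "zigzag f r c k \<Longrightarrow> bigraph.zigzag adj S R f c r k"
  unfolding zigzag_def bigraph.zigzag_def[OF bigraph_swap]
  using adj_sym by (intro conjI) (metis, metis, metis, metis)

lemma zigzag_mono:
  assumes "zigzag f r c k" and "i \<le> j" "j \<le> k"
  shows "f (r i) \<le> f (r j)"
  using assms(2,3)
proof (induction j rule: dec_induct)
  case (step m)
  then show ?case using assms(1) unfolding zigzag_def by (meson Suc_leD Suc_le_lessD less_imp_le order_trans)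
qed simp

text \<open>The new vertex r' is the last difference of \<open>c k\<close> and
  \<open>c (Suc k)\<close>, which \<open>r (Suc k)\<close> shows to differ. For j < k, r' lies
  beyond \<open>r (j + 2)\<close>, so it cannot tell \<open>c j\<close> from
  \<open>c (Suc j)\<close>; its nonadjacency to \<open>c k\<close> therefore descends to all earlier
  \<open>c j\<close>.\<close>

lemma zigzag_next:
  assumes f: "doubly_lexical f" and zz: "zigzag f r c (Suc k)"
  obtains r' where "r' \<in> R" "f (r (Suc k)) < f r'" "adj r' (c (Suc k))"
    "\<And>j. j \<le> k \<Longrightarrow> \<not> adj r' (c j)"
    "\<And>w. w \<in> R \<Longrightarrow> f r' < f w \<Longrightarrow> adj w (c k) = adj w (c (Suc k))"
proof -
  have side: "c k \<in> S" "c (Suc k) \<in> S" and less: "f (c k) < f (c (Suc k))"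
    using zz by (simp_all add: zigzag_def)
  have "adj (r (Suc k)) (c k)" "\<not> adj (r (Suc k)) (c (Suc k))"
    using zz by (simp_all add: zigzag_def)
  then have "adj (c k) (r (Suc k))" "\<not> adj (c (Suc k)) (r (Suc k))" using adj_sym by blast+
  then obtain r' where r': "f (r (Suc k)) < f r'" "adj (c (Suc k)) r'" "\<not> adj (c k) r'"
    and agree: "\<And>y. y \<in> R \<union> S \<Longrightarrow> f r' < f y \<Longrightarrow> adj (c k) y = adj (c (Suc k)) y"
    using last_difference[OF f _ less] side by blast
  have "r' \<in> R" using r'(2) side adj_sides disjoint by blast
  have "\<not> adj r' (c j)" if "j \<le> k" for j
    using that
  proof (induction j rule: inc_induct)
    case base
    then show ?case using r' adj_sym by blast
  next
    case (step j)
    then have "f (r (j + 2)) < f r'"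
      using zigzag_mono[OF zz, of "j + 2" "Suc k"] r'(1) by simp
    then have "adj r' (c j) = adj r' (c (Suc j))"
      using zz step \<open>r' \<in> R\<close> unfolding zigzag_def by simp
    then show ?case using step by simp
  qed
  then show ?thesis
    using that[OF \<open>r' \<in> R\<close> r'(1)] r' agree adj_sym by (meson UnI1)
qed

text \<open>Both ends grow at once, the S end by applying \<open>zigzag_next\<close> to the swapped
  bigraph. The one adjacency left open is that of r' and c': an edge there would close a long cycle
  by \<open>zigzag_closes\<close>, and its absence is what the longer zigzag requires.\<close>

lemma zigzag_extend:
  assumes f: "doubly_lexical f" and zz: "zigzag f r c (Suc k)" and no: "\<nexists>vs. long_cycle vs"
  shows "\<exists>r c. zigzag f r c (Suc (Suc k))"
proof -
  interpret s: bigraph adj S R by (rule bigraph_swap)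
  have sf: "s.doubly_lexical f"
    using f by (auto simp: doubly_lexical_def s.doubly_lexical_def Un_commute)
  let ?K = "Suc (Suc k)"
  obtain r' where r': "r' \<in> R" "f (r (Suc k)) < f r'" "adj r' (c (Suc k))"
    "\<And>j. j \<le> k \<Longrightarrow> \<not> adj r' (c j)"
    "\<And>w. w \<in> R \<Longrightarrow> f r' < f w \<Longrightarrow> adj w (c k) = adj w (c (Suc k))"
    using zigzag_next[OF f zz] by blast
  obtain c' where c'0: "c' \<in> S" "f (c (Suc k)) < f c'" "adj c' (r (Suc k))"
    "\<And>j. j \<le> k \<Longrightarrow> \<not> adj c' (r j)"
    "\<And>w. w \<in> S \<Longrightarrow> f c' < f w \<Longrightarrow> adj w (r k) = adj w (r (Suc k))"
    using s.zigzag_next[OF sf zigzag_swap[OF zz]] by blast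
  have c': "c' \<in> S" "f (c (Suc k)) < f c'" "adj (r (Suc k)) c'"
    "\<And>j. j \<le> k \<Longrightarrow> \<not> adj (r j) c'"
    "\<And>w. w \<in> S \<Longrightarrow> f c' < f w \<Longrightarrow> adj (r k) w = adj (r (Suc k)) w"
    using c'0 adj_sym by blast+
  let ?r = "r(?K := r')" and ?c = "c(?K := c')"
  have in_sides: "?r i \<in> R" "?c i \<in> S" if "i \<le> ?K" for i
    using zz r'(1) c'(1) that by (auto simp: zigzag_def)
  have pattern: "adj (?r i) (?c j) \<longleftrightarrow>
      i = 0 \<and> j = 0 \<or> i = Suc j \<or> j = Suc i \<or> i = ?K \<and> j = ?K \<and> adj r' c'"
    if "i \<le> ?K" "j \<le> ?K" for i j
  proof (cases "i = ?K"; cases "j = ?K")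
    assume "i \<noteq> ?K" "j \<noteq> ?K"
    then show ?thesis using zz that by (simp add: zigzag_def)
  next
    assume "i = ?K" "j \<noteq> ?K"
    then show ?thesis using r'(3) r'(4)[of j] that by (cases "j = Suc k") auto
  next
    assume "i \<noteq> ?K" "j = ?K"
    then show ?thesis using c'(3) c'(4)[of i] that by (cases "i = Suc k") auto
  qed simp
  have less: "f (?r i) < f (?r (Suc i))" "f (?c i) < f (?c (Suc i))" if "i < ?K" for i
    using zz r'(2) c'(2) that by (cases "i = Suc k"; simp add: zigzag_def)+
  have "\<not> adj r' c'"
  proof
    assume "adj r' c'"
    moreover have "inj_on ?r {..?K}" "inj_on ?c {..?K}"
      using less by (intro inj_on_increasing[of _ f]; simp)+
    ultimately have "\<exists>vs. long_cycle vs"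
      using in_sides pattern by (intro zigzag_closes[of ?K ?r ?c]) simp_all
    then show False using no by blast
  qed
  then have "zigzag f ?r ?c ?K"
    unfolding zigzag_def
  proof (intro conjI allI impI ballI)
    fix i w assume i: "i + 2 \<le> ?K"
    show "adj w (?c i) = adj w (?c (Suc i))" if "w \<in> R" "f (?r (i + 2)) < f w"
      using zz r'(5) that i by (cases "i = k") (auto simp: zigzag_def)
    show "adj (?r i) w = adj (?r (Suc i)) w" if "w \<in> S" "f (?c (i + 2)) < f w"
      using zz c'(5) that i by (cases "i = k") (auto simp: zigzag_def)
  qed (use in_sides pattern less in auto)
  then show ?thesis by blast
qed

lemma ex_comparable_nbrs:
  assumes no: "\<nexists>vs. long_cycle vs" and "R \<noteq> {}"
  shows "\<exists>u\<in>R. \<forall>a b. adj u a \<longrightarrow> adj u b \<longrightarrow>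
    {v. adj a v} \<subseteq> {v. adj b v} \<or> {v. adj b v} \<subseteq> {v. adj a v}"
proof -
  obtain f where f: "doubly_lexical f" using ex_doubly_lexical by blast
  then have inj: "inj_on f (R \<union> S)" by (simp add: doubly_lexical_def)
  obtain u where u: "u \<in> R" and min: "\<And>w. w \<in> R \<Longrightarrow> f u \<le> f w"
    using ex_has_least_nat[of "\<lambda>u. u \<in> R"] \<open>R \<noteq> {}\<close> by blast
  have nested: "{v. adj a v} \<subseteq> {v. adj b v}" if ab: "adj u a" "adj u b" "f a < f b" for a b
  proof (rule ccontr)
    assume "\<not> {v. adj a v} \<subseteq> {v. adj b v}"
    then obtain w where w: "adj a w" "\<not> adj b w" by blast
    have "a \<in> S" "b \<in> S" using ab u adj_side by blast+
    then have "w \<in> R" using w adj_sides disjoint by blast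
    moreover have "w \<noteq> u" using w ab adj_sym by blast
    ultimately have "f u < f w"
      using min inj u by (metis UnI1 inj_on_eq_iff order_le_imp_less_or_eq)
    \<comment> \<open>The initial path is w, a, u, b. Its rows are in order because u is the least
      vertex of R.\<close>
    have "zigzag f (\<lambda>i. if i = 0 then u else w) (\<lambda>i. if i = 0 then a else b) (Suc 0)"
      using u \<open>w \<in> R\<close> \<open>a \<in> S\<close> \<open>b \<in> S\<close> \<open>f u < f w\<close> ab w adj_sym
      by (auto simp: zigzag_def le_Suc_eq)
    \<comment> \<open>Zigzags of every length would exist, although their r-vertices are distinct
      members of the finite set R.\<close>
    then have "\<exists>r c. zigzag f r c (Suc k)" for k
      by (induction k) (use zigzag_extend[OF f _ no] in blast)+
    then obtain r c where zz: "zigzag f r c (Suc (card R))" by blast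
    then have "inj_on r {..Suc (card R)}"
      by (intro inj_on_increasing[of _ f]) (simp add: zigzag_def)
    moreover have "r ` {..Suc (card R)} \<subseteq> R" using zz by (auto simp: zigzag_def)
    ultimately show False using card_inj_on_le[OF _ _ finite_R] by fastforce
  qed
  have "{v. adj a v} \<subseteq> {v. adj b v} \<or> {v. adj b v} \<subseteq> {v. adj a v}" if "adj u a" "adj u b" for a b
  proof (cases "f a" "f b" rule: linorder_cases)
    case equal
    then have "a = b" using inj adj_side[OF _ u] that by (meson UnI2 inj_onD)
    then show ?thesis by simp
  qed (use nested that in blast)+
  then show ?thesis using u by blast
qed

end

section \<open>Weak-simplicial vertices\<close>

lemma dominates_induce: "u \<rightarrow>\<^bsub>G \<restriction> X\<^esub> v \<longleftrightarrow> u \<in> X \<and> v \<in> X \<and> u \<rightarrow>\<^bsub>G\<^esub> v"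
  by (auto simp: arcs_ends_conv)

lemma WS_iff:
  "u \<in> WS G X \<longleftrightarrow> u \<in> X \<and> (\<forall>a\<in>X. \<forall>b\<in>X. u \<rightarrow>\<^bsub>G\<^esub> a \<longrightarrow> u \<rightarrow>\<^bsub>G\<^esub> b \<longrightarrow> \<not> a \<rightarrow>\<^bsub>G\<^esub> b \<and>
     ({w \<in> X. a \<rightarrow>\<^bsub>G\<^esub> w} \<subseteq> {w \<in> X. b \<rightarrow>\<^bsub>G\<^esub> w} \<or> {w \<in> X. b \<rightarrow>\<^bsub>G\<^esub> w} \<subseteq> {w \<in> X. a \<rightarrow>\<^bsub>G\<^esub> w}))"
proof -
  have nbhd: "nbhd (G \<restriction> X) a = {w \<in> X. a \<rightarrow>\<^bsub>G\<^esub> w}" if "a \<in> X" for a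
    using that by (auto simp: nbhd_def dominates_induce)
  show ?thesis
    by (cases "u \<in> X")
      (auto simp: WS_def weak_simplicial_def independent_set_def comparable_def nbhd dominates_induce)
qed

lemma bipartite_induce:
  "bipartite (G \<restriction> X) \<longleftrightarrow> (\<exists>A B. X = A \<union> B \<and> A \<inter> B = {} \<and>
     (\<forall>a\<in>A. \<forall>b\<in>A. \<not> a \<rightarrow>\<^bsub>G\<^esub> b) \<and> (\<forall>a\<in>B. \<forall>b\<in>B. \<not> a \<rightarrow>\<^bsub>G\<^esub> b))"
  unfolding bipartite_def independent_set_def induce_subgraph_verts dominates_induce
  by (intro ex_cong1 conj_cong refl) auto

lemma induced_cycle_induce:
  "induced_cycle (G \<restriction> X) vs \<longleftrightarrow> 3 \<le> length vs \<and> distinct vs \<and> set vs \<subseteq> X \<and>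
     (\<forall>i<length vs. \<forall>j<length vs. vs ! i \<rightarrow>\<^bsub>G\<^esub> vs ! j \<longleftrightarrow>
        j = Suc i mod length vs \<or> i = Suc j mod length vs)"
  unfolding induced_cycle_def induce_subgraph_verts dominates_induce
  by (intro conj_cong all_cong1 imp_cong refl) (simp add: subsetD[OF _ nth_mem])

text \<open>Allows a chosen vertex of a cycle to be moved to position 0.\<close>

lemma induced_cycle_rotate:
  assumes "induced_cycle H vs" and "m < length vs"
  shows "induced_cycle H (rotate m vs)"
proof -
  let ?n = "length vs"
  have n: "0 < ?n" using assms(2) by linarith
  have inj: "(m + i) mod ?n = (m + j) mod ?n \<longleftrightarrow> i = j" if "i < ?n" "j < ?n" for i j
  proof -
    have "(m + i) mod ?n = (if m + i < ?n then m + i else m + i - ?n)" if "i < ?n" for i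
      using that assms(2) by (simp add: le_mod_geq)
    from this[of i] this[of j] show ?thesis using that assms(2) by (simp split: if_splits) linarith
  qed
  have Suc: "Suc ((m + i) mod ?n) mod ?n = (m + (Suc i mod ?n)) mod ?n" for i
    by (simp add: mod_Suc_eq mod_add_right_eq)
  show ?thesis
    using assms(1) n unfolding induced_cycle_def
    by (simp add: nth_rotate Suc inj)
qed

section \<open>Solutions under deletion and insertion of vertices\<close>

lemma solution_subset:
  assumes "solution G X" and "Y \<subseteq> X"
  shows "solution G Y"
proof -
  have "bipartite (G \<restriction> Y)"
  proof -
    obtain A B where "X = A \<union> B" "A \<inter> B = {}"
      "\<forall>a\<in>A. \<forall>b\<in>A. \<not> a \<rightarrow>\<^bsub>G\<^esub> b" "\<forall>a\<in>B. \<forall>b\<in>B. \<not> a \<rightarrow>\<^bsub>G\<^esub> b"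
      using assms(1) by (auto simp: solution_def chordal_bipartite_def bipartite_induce)
    then show ?thesis
      unfolding bipartite_induce using assms(2)
      by (intro exI[of _ "A \<inter> Y"] exI[of _ "B \<inter> Y"]) blast
  qed
  moreover have "induced_cycle (G \<restriction> X) vs" if "induced_cycle (G \<restriction> Y) vs" for vs
    using that assms(2) by (auto simp: induced_cycle_induce)
  ultimately show ?thesis
    using assms unfolding solution_def chordal_bipartite_def by blast
qed

context graph
begin

lemma dominates_sym: "u \<rightarrow>\<^bsub>G\<^esub> v \<Longrightarrow> v \<rightarrow>\<^bsub>G\<^esub> u"
  using sym_arcs by (auto simp: symmetric_def sym_def)

lemma finite_solution: "solution G X \<Longrightarrow> finite X"
  by (metis finite_verts finite_subset solution_def)

lemma ex_WS:
  assumes sol: "solution G X" and "X \<noteq> {}"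
  shows "WS G X \<noteq> {}"
proof -
  \<comment> \<open>Adjacency is cut down to X because \<open>bigraph\<close> demands that every
    edge run between R and S.\<close>
  let ?adj = "\<lambda>u v. u \<in> X \<and> v \<in> X \<and> u \<rightarrow>\<^bsub>G\<^esub> v"
  have WS: "WS G X \<noteq> {}"
    if X: "X = R \<union> S" and "R \<inter> S = {}" and R: "\<forall>a\<in>R. \<forall>b\<in>R. \<not> a \<rightarrow>\<^bsub>G\<^esub> b" and S: "\<forall>a\<in>S. \<forall>b\<in>S. \<not> a \<rightarrow>\<^bsub>G\<^esub> b"
      and "R \<noteq> {}" for R S
  proof -
    interpret b: bigraph ?adj R S
    proof
      show "finite R" "finite S" using finite_solution[OF sol] X by simp_all
      show "R \<inter> S = {}" by fact
      fix u v assume uv: "?adj u v"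
      then show "?adj v u" using dominates_sym by blast
      show "u \<in> R \<and> v \<in> S \<or> u \<in> S \<and> v \<in> R" using uv X R S by blast
    qed
    have "\<not> b.long_cycle vs" for vs
    proof
      assume "b.long_cycle vs"
      note lc = this[unfolded b.long_cycle_def, folded X]
      have vs: "6 \<le> length vs" "distinct vs" "set vs \<subseteq> X" using lc by blast+
      have "vs ! i \<in> X" if "i < length vs" for i using vs(3) that by auto
      then have "\<forall>i<length vs. \<forall>j<length vs. vs ! i \<rightarrow>\<^bsub>G\<^esub> vs ! j \<longleftrightarrow>
          j = Suc i mod length vs \<or> i = Suc j mod length vs"
        using lc by simp
      then have "induced_cycle (G \<restriction> X) vs" using vs by (simp add: induced_cycle_induce)
      then show False using sol vs(1) by (auto simp: solution_def chordal_bipartite_def)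
    qed
    then obtain u where u: "u \<in> R"
      and comp: "\<And>a b. ?adj u a \<Longrightarrow> ?adj u b \<Longrightarrow>
        {v. ?adj a v} \<subseteq> {v. ?adj b v} \<or> {v. ?adj b v} \<subseteq> {v. ?adj a v}"
      using b.ex_comparable_nbrs \<open>R \<noteq> {}\<close> by blast
    have "u \<in> WS G X"
      unfolding WS_iff
    proof (intro conjI ballI impI)
      fix a b assume ab: "a \<in> X" "b \<in> X" "u \<rightarrow>\<^bsub>G\<^esub> a" "u \<rightarrow>\<^bsub>G\<^esub> b"
      show "\<not> a \<rightarrow>\<^bsub>G\<^esub> b" using R S u ab X by blast
      show "{w \<in> X. a \<rightarrow>\<^bsub>G\<^esub> w} \<subseteq> {w \<in> X. b \<rightarrow>\<^bsub>G\<^esub> w} \<or> {w \<in> X. b \<rightarrow>\<^bsub>G\<^esub> w} \<subseteq> {w \<in> X. a \<rightarrow>\<^bsub>G\<^esub> w}"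
        using comp[of a b] ab u X by simp
    qed (use u X in blast)
    then show ?thesis by blast
  qed
  obtain A B where "X = A \<union> B" "A \<inter> B = {}"
    "\<forall>a\<in>A. \<forall>b\<in>A. \<not> a \<rightarrow>\<^bsub>G\<^esub> b" "\<forall>a\<in>B. \<forall>b\<in>B. \<not> a \<rightarrow>\<^bsub>G\<^esub> b"
    using sol by (auto simp: solution_def chordal_bipartite_def bipartite_induce)
  \<comment> \<open>One side may be empty; as X is not, the other side can then play the role of
    R.\<close>
  then show ?thesis
    using WS[of A B] WS[of B A] \<open>X \<noteq> {}\<close> by (cases "A = {}") (simp_all add: Un_commute Int_commute)
qed

text \<open>The two neighbours of v on such a cycle each have a further neighbour on it that the
  other lacks. They are thus incomparable, which contradicts v being weak-simplicial.\<close>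

lemma no_long_cycle_through_WS:
  assumes cycle: "induced_cycle (G \<restriction> X) vs" and len: "6 \<le> length vs" and "v \<in> WS G X"
  shows "v \<notin> set vs"
proof
  assume "v \<in> set vs"
  then obtain m where m: "m < length vs" "vs ! m = v" by (auto simp: in_set_conv_nth)
  define ws where "ws = rotate m vs"
  define n where "n = length ws"
  have n: "6 \<le> n" using len by (simp add: n_def ws_def)
  have sub: "set ws \<subseteq> X" and adj: "\<And>i j. i < n \<Longrightarrow> j < n \<Longrightarrow>
      ws ! i \<rightarrow>\<^bsub>G\<^esub> ws ! j \<longleftrightarrow> j = Suc i mod n \<or> i = Suc j mod n"
    using induced_cycle_rotate[OF cycle m(1)] by (auto simp: induced_cycle_induce n_def ws_def)
  have in_X: "ws ! i \<in> X" if "i < n" for i using sub that by (auto simp: n_def)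
  have "ws ! 0 = v" using m nth_rotate[of 0 vs m] by (cases "vs = []") (auto simp: ws_def)
  moreover have "ws ! 0 \<rightarrow>\<^bsub>G\<^esub> ws ! 1" "ws ! 0 \<rightarrow>\<^bsub>G\<^esub> ws ! (n - 1)"
    "ws ! 1 \<rightarrow>\<^bsub>G\<^esub> ws ! 2" "\<not> ws ! (n - 1) \<rightarrow>\<^bsub>G\<^esub> ws ! 2"
    "ws ! (n - 1) \<rightarrow>\<^bsub>G\<^esub> ws ! (n - 2)" "\<not> ws ! 1 \<rightarrow>\<^bsub>G\<^esub> ws ! (n - 2)"
    using n by (auto simp: adj mod_Suc)
  moreover have "ws ! 1 \<in> X" "ws ! 2 \<in> X" "ws ! (n - 1) \<in> X" "ws ! (n - 2) \<in> X"
    using n in_X by auto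
  ultimately show False using \<open>v \<in> WS G X\<close> unfolding WS_iff by blast
qed

text \<open>Comparability forces all neighbours of v that have a neighbour in X onto one side of a
  bipartition of X; the remaining neighbours are isolated in X and may change sides. A long induced
  cycle cannot pass through v, and one that avoids v lies in X already.\<close>

lemma solution_insert:
  assumes sol: "solution G X" and v: "v \<in> AWS G X"
  shows "solution G (insert v X)"
proof -
  have v': "v \<in> verts G" "v \<notin> X" and ws: "v \<in> WS G (insert v X)"
    using v by (auto simp: AWS_def)
  have loop: "\<not> u \<rightarrow>\<^bsub>G\<^esub> u" for u using adj_not_same by blast
  have "bipartite (G \<restriction> insert v X)"
  proof -
    obtain A B where AB: "X = A \<union> B" "A \<inter> B = {}"
      and A: "\<And>a b. a \<in> A \<Longrightarrow> b \<in> A \<Longrightarrow> \<not> a \<rightarrow>\<^bsub>G\<^esub> b" and B: "\<And>a b. a \<in> B \<Longrightarrow> b \<in> B \<Longrightarrow> \<not> a \<rightarrow>\<^bsub>G\<^esub> b"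
      using sol by (auto simp: solution_def chordal_bipartite_def bipartite_induce)
    define I where "I = {a \<in> X. v \<rightarrow>\<^bsub>G\<^esub> a \<and> (\<forall>w\<in>X. \<not> a \<rightarrow>\<^bsub>G\<^esub> w)}"
    \<comment> \<open>Comparable neighbours of \<open>v\<close> outside \<open>I\<close> have a common neighbour in \<open>X\<close>.\<close>
    have same_side: "\<not> (a \<in> A \<and> b \<in> B)"
      if ab: "a \<in> X - I" "b \<in> X - I" "v \<rightarrow>\<^bsub>G\<^esub> a" "v \<rightarrow>\<^bsub>G\<^esub> b" for a b
    proof
      assume sides: "a \<in> A \<and> b \<in> B"
      obtain x y where "x \<in> X" "a \<rightarrow>\<^bsub>G\<^esub> x" "y \<in> X" "b \<rightarrow>\<^bsub>G\<^esub> y" using ab by (auto simp: I_def)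
      moreover have "{w \<in> insert v X. a \<rightarrow>\<^bsub>G\<^esub> w} \<subseteq> {w \<in> insert v X. b \<rightarrow>\<^bsub>G\<^esub> w} \<or>
          {w \<in> insert v X. b \<rightarrow>\<^bsub>G\<^esub> w} \<subseteq> {w \<in> insert v X. a \<rightarrow>\<^bsub>G\<^esub> w}"
        using ws ab unfolding WS_iff by blast
      ultimately obtain w where "w \<in> X" "a \<rightarrow>\<^bsub>G\<^esub> w" "b \<rightarrow>\<^bsub>G\<^esub> w" by blast
      then show False using sides A B AB by blast
    qed
    have indep: "\<not> a \<rightarrow>\<^bsub>G\<^esub> b" if "a \<in> X" "b \<in> X" "v \<rightarrow>\<^bsub>G\<^esub> a" "v \<rightarrow>\<^bsub>G\<^esub> b" for a b
      using ws that unfolding WS_iff by blast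
    have I: "\<not> a \<rightarrow>\<^bsub>G\<^esub> w" "\<not> w \<rightarrow>\<^bsub>G\<^esub> a" if "a \<in> I" "w \<in> X" for a w
      using that by (auto simp: I_def dest: dominates_sym)
    \<comment> \<open>P is the side that keeps the neighbours of v: v joins Q, and the isolated
      neighbours I leave Q for P.\<close>
    have split: ?thesis
      if "X = P \<union> Q" "P \<inter> Q = {}" "\<And>a b. a \<in> P \<Longrightarrow> b \<in> P \<Longrightarrow> \<not> a \<rightarrow>\<^bsub>G\<^esub> b"
        "\<And>a b. a \<in> Q \<Longrightarrow> b \<in> Q \<Longrightarrow> \<not> a \<rightarrow>\<^bsub>G\<^esub> b" "\<And>a. a \<in> Q - I \<Longrightarrow> \<not> v \<rightarrow>\<^bsub>G\<^esub> a" for P Q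
      unfolding bipartite_induce
    proof (intro exI conjI)
      show "insert v X = (P \<union> I) \<union> (insert v (Q - I))" using that by (auto simp: I_def)
      show "(P \<union> I) \<inter> insert v (Q - I) = {}" using that v' by (auto simp: I_def)
      show "\<forall>a\<in>P \<union> I. \<forall>b\<in>P \<union> I. \<not> a \<rightarrow>\<^bsub>G\<^esub> b"
        using that I by (metis (no_types, lifting) I_def UnE UnI1 mem_Collect_eq)
      show "\<forall>a\<in>insert v (Q - I). \<forall>b\<in>insert v (Q - I). \<not> a \<rightarrow>\<^bsub>G\<^esub> b"
        using that loop dominates_sym by blast
    qed
    show ?thesis
    proof (cases "\<exists>b\<in>B - I. v \<rightarrow>\<^bsub>G\<^esub> b")
      case True
      then have "\<not> v \<rightarrow>\<^bsub>G\<^esub> a" if "a \<in> A - I" for a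
        using same_side AB(1) that by blast
      then show ?thesis using AB A B by (intro split[of B A]) auto
    next
      case False
      then show ?thesis using AB A B by (intro split[of A B]) auto
    qed
  qed
  moreover have "\<not> 6 \<le> length vs" if cycle: "induced_cycle (G \<restriction> insert v X) vs" for vs
  proof
    assume len: "6 \<le> length vs"
    then have "v \<notin> set vs" using no_long_cycle_through_WS[OF cycle _ ws] by blast
    then have "induced_cycle (G \<restriction> X) vs"
      using cycle by (auto simp: induced_cycle_induce)
    then show False using sol len by (auto simp: solution_def chordal_bipartite_def)
  qed
  ultimately show ?thesis
    using sol v' by (auto simp: solution_def chordal_bipartite_def)
qed

text \<open>The distance \<open>\<mu>\<close> is an extended real. Taking a path that attains it
  reduces the claim to lengths: at most 2 by comparison with the given walk, and nonzero as u and v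
  differ.\<close>

lemma N12_I:
  assumes "u \<rightarrow>\<^bsub>G\<^esub> v \<or> (\<exists>w. u \<rightarrow>\<^bsub>G\<^esub> w \<and> w \<rightarrow>\<^bsub>G\<^esub> v)" and "u \<noteq> v"
  shows "v \<in> N12 G u"
proof -
  have cost: "awalk_cost (\<lambda>_. 1) p = length p" for p :: "'b list"
    by (induction p) (simp_all add: awalk_cost_def)
  obtain q where q: "awalk u q v" "length q \<le> 2"
  proof -
    consider e where "awalk u [e] v" | e f where "awalk u [e, f] v"
      using assms(1) by (force simp: arcs_ends_conv awalk_simps)
    then show ?thesis by cases (use that in force)+
  qed
  have "u \<rightarrow>\<^sup>* v" using q(1) by (auto simp: reachable_awalk)
  then obtain p where p: "apath u p v" "\<mu> (\<lambda>_. 1) u v = awalk_cost (\<lambda>_. 1) p"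
    using min_cost_awalk[of u v "\<lambda>_. 1"] by auto
  have "\<mu> (\<lambda>_. 1) u v \<le> awalk_cost (\<lambda>_. 1) q" by (rule min_cost_le_walk_cost[OF q(1)])
  then have "length p \<le> 2" using p(2) q(2) by (simp add: cost)
  moreover have "length p \<noteq> 0" using p(1) \<open>u \<noteq> v\<close> by (auto simp: apath_Nil_iff)
  ultimately have "length p = 1 \<or> length p = 2" by linarith
  then have "\<mu> (\<lambda>_. 1) u v \<in> {1, 2}" using p(2) by (auto simp: cost)
  moreover have "v \<in> verts G" using assms(1) adj_in_verts by blast
  ultimately show ?thesis by (simp add: N12_def)
qed

end

section \<open>The reverse search tree\<close>

text \<open>The descendants of X in the tree of parents, X included. The number of steps is
  determined, since \<open>Par\<close> removes exactly one vertex from a nonempty solution; the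
  bound on \<open>card X\<close> guards the truncated subtraction.\<close>

definition desc :: "(nat, 'b) pre_digraph \<Rightarrow> nat set \<Rightarrow> nat set set" where
  "desc G X = {Y. solution G Y \<and> card X \<le> card Y \<and> (Par G ^^ (card Y - card X)) Y = X}"

definition children :: "(nat, 'b) pre_digraph \<Rightarrow> nat set \<Rightarrow> nat set" where
  "children G X = {v \<in> C G X. Par G (X \<union> {v}) = X}"

lemma C_subset_AWS: "C G X \<subseteq> AWS G X"
  by (auto simp: C_def)

lemma WS_subset: "WS G X \<subseteq> X"
  by (auto simp: WS_iff)

lemma AWS_notin: "v \<in> AWS G X \<Longrightarrow> v \<notin> X"
  by (auto simp: AWS_def)

lemma solution_Par: "solution G X \<Longrightarrow> solution G (Par G X)"
  by (rule solution_subset) (auto simp: Par_def)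

lemma distinct_concat_disjoint:
  assumes "list_all2 (\<lambda>v xs. distinct xs \<and> set xs = D v) ws xss" and "distinct ws"
    and "\<And>v w. v \<in> set ws \<Longrightarrow> w \<in> set ws \<Longrightarrow> v \<noteq> w \<Longrightarrow> D v \<inter> D w = {}"
  shows "distinct (concat xss) \<and> set (concat xss) = (\<Union>v\<in>set ws. D v)"
  using assms
proof (induction rule: list_all2_induct)
  case (Cons v ws xs xss)
  then have IH: "distinct (concat xss)" "set (concat xss) = (\<Union>w\<in>set ws. D w)" by simp_all
  have "D v \<inter> D w = {}" if "w \<in> set ws" for w
    using Cons.prems that by auto
  then have "set xs \<inter> set (concat xss) = {}" using Cons.hyps IH by auto
  then show ?case using Cons.hyps IH by simp
qed simp

context
  fixes G :: "(nat, 'b) pre_digraph"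
  assumes G: "graph G"
begin

interpretation graph G by (rule G)

section \<open>Parents and candidate vertices\<close>

lemma pv_in_WS:
  assumes "solution G X" and "X \<noteq> {}"
  shows "pv G X \<in> WS G X"
  unfolding pv_def
  using ex_WS[OF assms] finite_subset[OF WS_subset finite_solution[OF assms(1)]] by (rule Max_in[rotated])

lemma pv_in: "solution G X \<Longrightarrow> X \<noteq> {} \<Longrightarrow> pv G X \<in> X"
  by (rule subsetD[OF WS_subset pv_in_WS])

lemma pv_in_AWS_Par:
  assumes "solution G Y" and "Y \<noteq> {}"
  shows "pv G Y \<in> AWS G (Par G Y)"
proof -
  have "Par G Y \<union> {pv G Y} = Y" using pv_in[OF assms] by (auto simp: Par_def)
  moreover have "pv G Y \<in> verts G"
    using pv_in[OF assms] assms(1) by (auto simp: solution_def)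
  ultimately show ?thesis using pv_in_WS[OF assms] by (simp add: AWS_def Par_def)
qed

text \<open>Being weak-simplicial depends only on the neighbours of p and on their neighbourhoods,
  and v enters none of these sets.\<close>

lemma WS_insert_far:
  assumes p: "p \<in> WS G X"
    and far: "\<not> p \<rightarrow>\<^bsub>G\<^esub> v" "\<nexists>w. p \<rightarrow>\<^bsub>G\<^esub> w \<and> w \<rightarrow>\<^bsub>G\<^esub> v"
  shows "p \<in> WS G (insert v X)"
  unfolding WS_iff
proof (intro conjI ballI impI)
  fix a b assume a: "a \<in> insert v X" "p \<rightarrow>\<^bsub>G\<^esub> a" and b: "b \<in> insert v X" "p \<rightarrow>\<^bsub>G\<^esub> b"
  have nbrs: "{w \<in> insert v X. c \<rightarrow>\<^bsub>G\<^esub> w} = {w \<in> X. c \<rightarrow>\<^bsub>G\<^esub> w}" if "p \<rightarrow>\<^bsub>G\<^esub> c" for c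
    using that far(2) by auto
  have "a \<in> X" "b \<in> X" using a b far(1) by auto
  then show "\<not> a \<rightarrow>\<^bsub>G\<^esub> b" and "{w \<in> insert v X. a \<rightarrow>\<^bsub>G\<^esub> w} \<subseteq> {w \<in> insert v X. b \<rightarrow>\<^bsub>G\<^esub> w} \<or>
      {w \<in> insert v X. b \<rightarrow>\<^bsub>G\<^esub> w} \<subseteq> {w \<in> insert v X. a \<rightarrow>\<^bsub>G\<^esub> w}"
    unfolding nbrs[OF a(2)] nbrs[OF b(2)] using p a(2) b(2) unfolding WS_iff by blast+
qed (use p in \<open>simp add: WS_iff\<close>)

lemma pv_in_C_Par:
  assumes sol: "solution G Y" and ne: "Y \<noteq> {}"
  shows "pv G Y \<in> C G (Par G Y)"
proof -
  let ?v = "pv G Y" and ?X = "Par G Y"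
  let ?p = "pv G ?X"
  note v = pv_in_AWS_Par[OF assms]
  \<comment> \<open>The cases mirror the definition of \<open>C\<close>; membership in
    \<open>AWS\<close> settles the first two at once.\<close>
  consider "?X = {}" | "?p \<le> ?v" | "?X \<noteq> {}" "?v < ?p" by linarith
  then show ?thesis
  proof cases
    case 3
    have p: "?p \<in> WS G ?X" by (rule pv_in_WS[OF solution_Par[OF sol] 3(1)])
    have Y: "insert ?v ?X = Y" using pv_in[OF assms] by (auto simp: Par_def)
    \<comment> \<open>By definition ?v is the largest weak-simplicial vertex of Y, so the larger ?p
      cannot be one.\<close>
    have "?p \<notin> WS G Y"
    proof
      assume "?p \<in> WS G Y"
      then have "?p \<le> ?v"
        unfolding pv_def[of G Y]
        using finite_subset[OF WS_subset finite_solution[OF sol]] by (rule Max_ge[rotated])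
      then show False using 3(2) by simp
    qed
    then have "?p \<rightarrow>\<^bsub>G\<^esub> ?v \<or> (\<exists>w. ?p \<rightarrow>\<^bsub>G\<^esub> w \<and> w \<rightarrow>\<^bsub>G\<^esub> ?v)"
      using WS_insert_far[OF p, of ?v] unfolding Y by blast
    then have "?v \<in> N12 G ?p" using 3(2) by (intro N12_I) simp_all
    then show ?thesis using v 3(1) by (simp add: C_def)
  qed (use v in \<open>auto simp: C_def\<close>)
qed

lemma card_Par: "solution G X \<Longrightarrow> X \<noteq> {} \<Longrightarrow> card (Par G X) = card X - 1"
  by (simp add: Par_def pv_in)

section \<open>Descendants in the search tree\<close>

lemma funpow_Par:
  assumes "solution G Y" and "k \<le> card Y"
  shows "solution G ((Par G ^^ k) Y) \<and> card ((Par G ^^ k) Y) = card Y - k"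
  using assms(2)
proof (induction k)
  case (Suc k)
  let ?Z = "(Par G ^^ k) Y"
  have Z: "solution G ?Z" "card ?Z = card Y - k" using Suc by simp_all
  then have "?Z \<noteq> {}" using Suc.prems by auto
  then show ?case using Z solution_Par card_Par[OF Z(1)] by simp
qed (use assms(1) in simp)

text \<open>On the way from a proper descendant Y to X, the last solution ?Z before X is X with
  \<open>pv G ?Z\<close> added, and \<open>pv_in_C_Par\<close> guarantees that the loop at X tries
  this vertex. Conversely, a child has one vertex more than X, so one additional \<open>Par\<close>
  step leads to X.\<close>

lemma desc_eq:
  assumes X: "solution G X"
  shows "desc G X = insert X (\<Union>v\<in>children G X. desc G (X \<union> {v}))"
proof (intro set_eqI iffI)
  fix Y assume "Y \<in> desc G X"
  then have Y: "solution G Y" "card X \<le> card Y" "(Par G ^^ (card Y - card X)) Y = X"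
    by (simp_all add: desc_def)
  show "Y \<in> insert X (\<Union>v\<in>children G X. desc G (X \<union> {v}))"
  proof (cases "card Y - card X")
    case 0
    then show ?thesis using Y by simp
  next
    case (Suc m)
    let ?Z = "(Par G ^^ m) Y"
    have Z: "solution G ?Z" "card ?Z = Suc (card X)"
      using funpow_Par[OF Y(1), of m] Suc by simp_all
    have ne: "?Z \<noteq> {}" using Z(2) by auto
    have Par: "Par G ?Z = X" using Y(3) Suc by simp
    have union: "X \<union> {pv G ?Z} = ?Z" using pv_in[OF Z(1) ne] Par by (auto simp: Par_def)
    have "pv G ?Z \<in> children G X"
      unfolding children_def using pv_in_C_Par[OF Z(1) ne] Par union by simp
    moreover have "Y \<in> desc G (X \<union> {pv G ?Z})"
    proof -
      have "card Y - Suc (card X) = m" "Suc (card X) \<le> card Y" using Suc by linarith+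
      then show ?thesis unfolding desc_def union using Y(1) Z(2) by simp
    qed
    ultimately show ?thesis by blast
  qed
next
  fix Y assume "Y \<in> insert X (\<Union>v\<in>children G X. desc G (X \<union> {v}))"
  then consider "Y = X" | v where "v \<in> children G X" "Y \<in> desc G (X \<union> {v})" by blast
  then show "Y \<in> desc G X"
  proof cases
    case 2
    then have "card (X \<union> {v}) = Suc (card X)"
      using AWS_notin C_subset_AWS finite_solution[OF X] by (fastforce simp: children_def)
    then have "card Y - card X = Suc (card Y - card (X \<union> {v}))" "card X \<le> card Y"
      using 2(2) by (auto simp: desc_def)
    then show ?thesis using 2 by (simp add: desc_def children_def)
  qed (use X in \<open>simp add: desc_def\<close>)
qed

lemma child_not_in: "v \<in> children G X \<Longrightarrow> v \<notin> X"
  using AWS_notin C_subset_AWS by (fastforce simp: children_def)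

section \<open>Correctness and termination of the executions\<close>

lemma Rec_correct:
  assumes "Rec G X outs" and "solution G X"
  shows "distinct outs \<and> set outs = desc G X"
  using assms
proof (induction rule: Rec.induct)
  case (1 vs X outss)
  let ?ws = "filter (\<lambda>v. Par G (X \<union> {v}) = X) vs"
  have ws: "set ?ws = children G X" "distinct ?ws" using 1 by (auto simp: children_def)
  have card: "card (X \<union> {v}) = Suc (card X)" if "v \<in> children G X" for v
    using child_not_in[OF that] finite_solution[OF 1(4)] by simp
  have "solution G (X \<union> {v})" if "v \<in> children G X" for v
    using solution_insert[OF 1(4), of v] that C_subset_AWS[of G X] by (auto simp: children_def)
  then have "list_all2 (\<lambda>v outs. distinct outs \<and> set outs = desc G (X \<union> {v})) ?ws outss"
    using 1(3) ws(1) by (auto intro: list.rel_mono_strong)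
  \<comment> \<open>All children of X have the same size, and Y determines its ancestor of that
    size, so no Y descends from two of them.\<close>
  moreover have "desc G (X \<union> {v}) \<inter> desc G (X \<union> {w}) = {}"
    if "v \<in> set ?ws" "w \<in> set ?ws" "v \<noteq> w" for v w
  proof -
    have "v \<in> children G X" "w \<in> children G X" using that ws by blast+
    then have "card (X \<union> {v}) = card (X \<union> {w})" "X \<union> {v} \<noteq> X \<union> {w}"
      using card child_not_in \<open>v \<noteq> w\<close> by (simp, blast)
    then show ?thesis by (auto simp: desc_def)
  qed
  ultimately have outss: "distinct (concat outss)"
    "set (concat outss) = (\<Union>v\<in>children G X. desc G (X \<union> {v}))"
    using distinct_concat_disjoint[of "\<lambda>v. desc G (X \<union> {v})" ?ws outss] ws by blast+
  \<comment> \<open>X is smaller than each of its children, whereas descendants are at least as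
    large as their ancestor.\<close>
  moreover have "X \<notin> desc G (X \<union> {v})" if "v \<in> children G X" for v
    using card[OF that] by (simp add: desc_def)
  ultimately show ?case using desc_eq[OF 1(4)] by simp
qed

text \<open>Each recursive call adds a vertex outside X, so the complement of X shrinks.\<close>

lemma Rec_terminates: "X \<subseteq> verts G \<Longrightarrow> \<exists>outs. Rec G X outs"
proof (induction "card (verts G - X)" arbitrary: X rule: less_induct)
  case less
  have C: "C G X \<subseteq> verts G - X" using C_subset_AWS by (fastforce simp: AWS_def)
  then obtain vs where vs: "set vs = C G X" "distinct vs"
    using finite_distinct_list finite_subset finite_verts by (metis finite_Diff)
  let ?ws = "filter (\<lambda>v. Par G (X \<union> {v}) = X) vs"
  have "\<exists>outs. Rec G (X \<union> {v}) outs" if "v \<in> set ?ws" for v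
  proof (rule less.hyps)
    have v: "v \<in> verts G - X" using that vs C by auto
    then show "X \<union> {v} \<subseteq> verts G" using less.prems by blast
    show "card (verts G - (X \<union> {v})) < card (verts G - X)"
      using v by (intro psubset_card_mono) auto
  qed
  then obtain g where "\<And>v. v \<in> set ?ws \<Longrightarrow> Rec G (X \<union> {v}) (g v)" by metis
  then have "list_all2 (\<lambda>v outs. Rec G (X \<union> {v}) outs) ?ws (map g ?ws)"
    by (simp add: list_all2_map2 list_all2_same)
  then show ?case using Rec.intros[OF vs(2,1)] by blast
qed

lemma solution_empty: "solution G {}"
  by (auto simp: solution_def chordal_bipartite_def bipartite_induce induced_cycle_induce)

text \<open>Every solution Y loses all its vertices in \<open>card Y\<close> steps, so the tree
  rooted at {} contains every solution.\<close>

lemma desc_empty: "desc G {} = {X. solution G X}"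
proof -
  have "(Par G ^^ card Y) Y = {}" if "solution G Y" for Y
  proof -
    have "solution G ((Par G ^^ card Y) Y)" "card ((Par G ^^ card Y) Y) = 0"
      using funpow_Par[OF that, of "card Y"] by simp_all
    then show ?thesis using finite_solution by (metis card_0_eq)
  qed
  then show ?thesis by (auto simp: desc_def)
qed

end

theorem theorem4:
  fixes G :: "(nat, 'b) pre_digraph" and n :: nat
  assumes "graph G" and "verts G = {1..n}"
  shows "(\<exists>outs. EnumCB G outs) \<and>
         (\<forall>outs. EnumCB G outs \<longrightarrow> distinct outs \<and> set outs = {X. solution G X})"
  using Rec_terminates[OF assms(1), of "{}"] Rec_correct[OF assms(1) _ solution_empty[OF assms(1)]]
    desc_empty[OF assms(1)]
  by (simp add: EnumCB_def)

end
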